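(* Let $q$ be a prime power, $n\ge1$, $\sigma$ a generator of $\mathrm{Gal}(\mathbb{F}_{q^n}/\mathbb{F}_q)$, and let $L=a_0x+a_1x^{\sigma}+\dots+a_dx^{\sigma^d}\in\mathbb{F}_{q^n}[x]$ have $\sigma$-degree $d\ge1$ and $a_0\neq 0$. Then $P_L$ has exactly $\frac{q^d-1}{q-1}$ roots in $\mathbb{F}_{q^n}$ if and only if $A_L=\lambda I$ for some $\lambda\in\mathbb{F}_q$. Also, $L$ has $q^d$ roots in $\mathbb{F}_{q^n}$ if and only if $A_L=I$.
   Context: $x^\sigma=x^{q^s}$ for some $s$ with $\gcd(s,n)=1$; for a matrix $M$ over $\mathbb{F}_{q^n}$, $M^{\sigma}$ denotes entrywise application of $\sigma$. For $y\in\mathbb{F}_{q^n}$, $y^{[i]}:=y^{1+\sigma+\dots+\sigma^{i-1}}$ ($y^{[0]}=1$). The projective polynomial associated to $L$ is $P_L(y)=\sum_{i=0}^d a_iy^{[i]}$. The companion matrix $C_L$ is the $d\times d$ matrix with $1$'s on the subdiagonal, last column $(-a_0/a_d,\dots,-a_{d-1}/a_d)^T$, zeros elsewhere, and $A_L:=C_LC_L^{\sigma}\cdots C_L^{\sigma^{n-1}}$. Roots are counted in $\mathbb{F}_{q^n}$. *)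

theory Defs
  imports "Jordan_Normal_Form.Matrix" "HOL-Computational_Algebra.Polynomial"
    "HOL-Number_Theory.Prime_Powers"
begin

definition is_subfield :: "'a::field set \<Rightarrow> bool" where
  "is_subfield K \<longleftrightarrow> 0 \<in> K \<and> 1 \<in> K \<and>
     (\<forall>x\<in>K. \<forall>y\<in>K. x + y \<in> K \<and> x * y \<in> K) \<and>
     (\<forall>x\<in>K. - x \<in> K \<and> inverse x \<in> K)"

definition gal :: "'a::field set \<Rightarrow> ('a \<Rightarrow> 'a) set" where
  "gal K = {f. bij f \<and> (\<forall>x y. f (x + y) = f x + f y) \<and>
               (\<forall>x y. f (x * y) = f x * f y) \<and> (\<forall>x\<in>K. f x = x)}"

text \<open>Natural-number powers suffice here because the definition is only used for finite fields,
  whose Galois groups are finite.\<close>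

definition gal_generator :: "'a::field set \<Rightarrow> ('a \<Rightarrow> 'a) \<Rightarrow> bool" where
  "gal_generator K \<sigma> \<longleftrightarrow> \<sigma> \<in> gal K \<and> gal K = range (\<lambda>k::nat. \<sigma> ^^ k)"

text \<open>The automorphism acts as \<open>x \<mapsto> x ^ (q ^ s)\<close>, so its \<open>i\<close>-th power raises to
  \<open>q ^ (s * i)\<close>; the second exponent is the sum of the first \<open>i\<close> of these, starting from \<open>1\<close>.\<close>

definition lin_poly :: "nat \<Rightarrow> nat \<Rightarrow> nat \<Rightarrow> (nat \<Rightarrow> 'a::field) \<Rightarrow> 'a poly" where
  "lin_poly q s d a = (\<Sum>i\<le>d. monom (a i) (q ^ (s * i)))"

definition proj_poly :: "nat \<Rightarrow> nat \<Rightarrow> nat \<Rightarrow> (nat \<Rightarrow> 'a::field) \<Rightarrow> 'a poly" where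
  "proj_poly q s d a = (\<Sum>i\<le>d. monom (a i) (\<Sum>j<i. q ^ (s * j)))"

definition companion :: "nat \<Rightarrow> (nat \<Rightarrow> 'a::field) \<Rightarrow> 'a mat" where
  "companion d a = mat d d (\<lambda>(i, j).
     if j = d - 1 then - a i / a d else if i = j + 1 then 1 else 0)"

definition twisted_prod :: "('a::field \<Rightarrow> 'a) \<Rightarrow> nat \<Rightarrow> nat \<Rightarrow> (nat \<Rightarrow> 'a) \<Rightarrow> 'a mat" where
  "twisted_prod \<sigma> n d a =
     foldr (*) (map (\<lambda>k. map_mat (\<sigma> ^^ k) (companion d a)) [0..<n]) (1\<^sub>m d)"

end

theory Submission imports Defs "HOL-Number_Theory.Cong" begin

text \<open>
  Put \<open>S\<^sub>z x = z * \<sigma> x\<close> and let \<open>V\<^sub>z\<close> be the kernel of \<open>\<Sum>i\<le>d. a i * S\<^sub>z\<^sup>i\<close>; the roots of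
  \<open>L\<close> are \<open>V\<^sub>1\<close>. By Hilbert 90 the roots of \<open>P\<^sub>L\<close> of norm \<open>Norm z\<close> are the \<open>S\<^sub>z x / x\<close> with
  \<open>x \<in> V\<^sub>z - {0}\<close>, each attained \<open>q - 1\<close> times. Splitting off right factors \<open>\<sigma> - y\<close> one at a time
  shows that the product of \<open>card V\<^sub>z\<close> over representatives \<open>z\<close> of the norm classes is at most
  \<open>q ^ d\<close>. Hence \<open>P\<^sub>L\<close> has \<open>(q ^ d - 1) / (q - 1)\<close> roots iff some \<open>V\<^sub>z\<close> has \<open>q ^ d\<close> elements.

  The columns of \<open>A\<^sub>L\<close> hold the coefficients of the remainders of \<open>\<sigma>\<^sup>n, \<dots>, \<sigma>\<^bsup>n+d-1\<^esup>\<close> modulo \<open>L\<close>. On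
  \<open>V\<^sub>z\<close> the operator \<open>S\<^sub>z\<^sup>n = Norm z\<close> agrees with its remainder, so if \<open>V\<^sub>z\<close> has \<open>q ^ d\<close> elements then
  comparing coefficients below degree \<open>d\<close> gives \<open>A\<^sub>L = Norm z * I\<close>. Conversely, if
  \<open>A\<^sub>L = Norm z * I\<close> then \<open>S\<^sub>z\<^sup>n - Norm z\<close> is a left multiple of \<open>L\<close> by an operator of degree
  \<open>n - d\<close>; as it vanishes identically, the image of \<open>L\<close> has at most \<open>q ^ (n - d)\<close> elements.
\<close>

section \<open>Counting by fibres, and sums against products\<close>

lemma card_fibres:
  fixes f :: "'b \<Rightarrow> 'c"
  assumes "finite A" and "f ` A = B" and "\<And>b. b \<in> B \<Longrightarrow> card {x\<in>A. f x = b} = k"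
  shows "card A = k * card B"
proof -
  have "card A = (\<Sum>x\<in>A. 1)" by simp
  also have "\<dots> = (\<Sum>y\<in>f ` A. \<Sum>x\<in>{x\<in>A. f x = y}. 1)"
    using assms(1) by (rule sum.image_gen)
  also have "\<dots> = (\<Sum>y\<in>B. k)" using assms(2,3) by simp
  finally show ?thesis by simp
qed

text \<open>A nonempty fibre of an additive map is a translate of its kernel, and the preimage is
  covered by \<open>card A\<close> fibres.\<close>

lemma card_vimage_additive_le:
  fixes g :: "'b::{ab_group_add,finite} \<Rightarrow> 'c::ab_group_add"
  assumes add: "\<And>x y. g (x + y) = g x + g y" and fin: "finite A"
  shows "card {x. g x \<in> A} \<le> card A * card {x. g x = 0}"
proof -
  have fibre: "card {x. g x = b} \<le> card {x. g x = 0}" for b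
  proof (cases "\<exists>x0. g x0 = b")
    case True
    then obtain x0 where x0: "g x0 = b" by blast
    have "g (x - x0) = 0" if "g x = b" for x
      using add[of "x - x0" x0] that x0 by simp
    then show ?thesis
      by (intro card_inj_on_le[where f = "\<lambda>x. x - x0"]) (auto simp: inj_on_def)
  qed simp
  have "{x. g x \<in> A} = (\<Union>b\<in>A. {x. g x = b})" by auto
  then have "card {x. g x \<in> A} \<le> (\<Sum>b\<in>A. card {x. g x = b})"
    using card_UN_le[OF fin, of "\<lambda>b. {x. g x = b}"] by simp
  also have "\<dots> \<le> (\<Sum>b\<in>A. card {x. g x = 0})" by (intro sum_mono fibre)
  finally show ?thesis by simp
qed

text \<open>Expanding the product of the \<open>1 + (k i - 1)\<close> gives 1, the sum of the
  \<open>k i - 1\<close>, and further nonnegative terms.\<close>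

lemma sum_pred_le_prod_pred:
  fixes k :: "'b \<Rightarrow> nat"
  assumes "finite I" and "\<And>i. i \<in> I \<Longrightarrow> k i \<ge> 1"
  shows "(\<Sum>i\<in>I. k i - 1) + 1 \<le> (\<Prod>i\<in>I. k i)"
  using assms
proof (induction I rule: finite_induct)
  case (insert i I)
  obtain u where u: "k i = Suc u" using insert.prems[of i] by (cases "k i") auto
  have IH: "(\<Sum>i\<in>I. k i - 1) + 1 \<le> (\<Prod>i\<in>I. k i)" using insert by auto
  then have "u * 1 \<le> u * (\<Prod>i\<in>I. k i)" by (intro mult_le_mono) auto
  with IH have "u + (\<Sum>i\<in>I. k i - 1) + 1 \<le> (\<Prod>i\<in>I. k i) + u * (\<Prod>i\<in>I. k i)" by linarith
  then show ?case using insert.hyps u by simp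
qed simp

text \<open>Two factors above 1 would push the product strictly above the sum plus 1, so under the
  cap \<open>Q\<close> a single factor must account for the extreme sum.\<close>

lemma sum_pred_eq_iff_of_prod_le:
  fixes k :: "'b \<Rightarrow> nat"
  assumes fin: "finite I" and ge: "\<And>i. i \<in> I \<Longrightarrow> k i \<ge> 1"
    and le: "(\<Prod>i\<in>I. k i) \<le> Q" and "Q > 1"
  shows "(\<Sum>i\<in>I. k i - 1) = Q - 1 \<longleftrightarrow> (\<exists>i\<in>I. k i = Q)"
proof
  assume sum: "(\<Sum>i\<in>I. k i - 1) = Q - 1"
  then obtain i where i: "i \<in> I" "k i - 1 \<noteq> 0"
    using \<open>Q > 1\<close> by (metis sum.neutral zero_less_diff less_irrefl)
  define P where "P = (\<Prod>j\<in>I - {i}. k j)"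
  define s where "s = (\<Sum>j\<in>I - {i}. k j - 1)"
  have sP: "s + 1 \<le> P" unfolding s_def P_def
    using fin ge by (intro sum_pred_le_prod_pred) auto
  have "k i * P \<le> Q" using le i fin by (simp add: P_def prod.remove)
  moreover have Q: "k i - 1 + s = Q - 1" using sum i fin by (simp add: s_def sum.remove)
  moreover obtain u where u: "k i = Suc (Suc u)" using i(2) by (cases "k i"; cases "k i - 1") auto
  moreover obtain p where p: "P = Suc p" using sP by (cases P) auto
  \<comment> \<open>This is \<open>k i * P \<le> Q\<close> with \<open>Q = k i + s\<close>, written
    in \<open>u\<close> and \<open>p\<close>; as \<open>s \<le> p\<close>, it leaves
    \<open>(u + 1) * p \<le> 0\<close>.\<close>
  ultimately have "p + u * p + p + 1 + u + 1 \<le> Suc (Suc u) + s" using \<open>Q > 1\<close> by simp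
  then have "p \<le> 0" using sP p by auto
  then have "s = 0" using sP p by simp
  then show "\<exists>i\<in>I. k i = Q" using Q u \<open>Q > 1\<close> i(1) by (intro bexI[of _ i]) auto
next
  assume "\<exists>i\<in>I. k i = Q"
  then obtain i where i: "i \<in> I" "k i = Q" by blast
  define P where "P = (\<Prod>j\<in>I - {i}. k j)"
  define s where "s = (\<Sum>j\<in>I - {i}. k j - 1)"
  have sP: "s + 1 \<le> P" unfolding s_def P_def
    using fin ge by (intro sum_pred_le_prod_pred) auto
  have "Q * P \<le> Q * 1" using le i fin by (simp add: P_def prod.remove)
  then have "P \<le> 1" using \<open>Q > 1\<close> by (subst (asm) mult_le_cancel1) auto
  then have "s = 0" using sP by simp
  then show "(\<Sum>i\<in>I. k i - 1) = Q - 1" using i fin by (simp add: s_def sum.remove)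
qed

section \<open>The cyclic extension and its automorphism\<close>

locale finite_cyclic_extension =
  fixes \<sigma> :: "'a::{field,finite} \<Rightarrow> 'a" and K :: "'a set" and q n :: nat
  assumes \<sigma>_add: "\<sigma> (x + y) = \<sigma> x + \<sigma> y"
    and \<sigma>_mult: "\<sigma> (x * y) = \<sigma> x * \<sigma> y"
    and fixed_iff: "\<sigma> x = x \<longleftrightarrow> x \<in> K"
    and \<sigma>_inj: "inj \<sigma>"
    and card_K: "card K = q"
    and \<sigma>_order: "(\<sigma> ^^ n) x = x"
    and card_UNIV: "card (UNIV :: 'a set) = q ^ n"
begin

lemma \<sigma>_0 [simp]: "\<sigma> 0 = 0"
  using \<sigma>_add[of 0 0] by (metis add.right_neutral add_left_cancel)

lemma \<sigma>_eq_0_iff [simp]: "\<sigma> x = 0 \<longleftrightarrow> x = 0"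
  using \<sigma>_inj \<sigma>_0 by (metis injD)

lemma \<sigma>_1 [simp]: "\<sigma> 1 = 1"
  using \<sigma>_mult[of 1 1] \<sigma>_eq_0_iff[of 1] by (metis mult_cancel_left2 mult_1 one_neq_zero)

lemma \<sigma>_minus: "\<sigma> (- x) = - \<sigma> x"
  using \<sigma>_add[of x "- x"] by (simp add: eq_neg_iff_add_eq_0 add.commute)

lemma \<sigma>_inverse: "\<sigma> (inverse x) = inverse (\<sigma> x)"
  using \<sigma>_mult[of x "inverse x"] by (cases "x = 0") (auto simp: field_simps)

lemma \<sigma>_divide: "\<sigma> (x / y) = \<sigma> x / \<sigma> y"
  by (simp add: divide_inverse \<sigma>_mult \<sigma>_inverse)

lemma \<sigma>_funpow_1 [simp]: "(\<sigma> ^^ i) 1 = 1"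
  by (induction i) auto

lemma \<sigma>_funpow_eq_0_iff [simp]: "(\<sigma> ^^ i) x = 0 \<longleftrightarrow> x = 0"
  by (induction i) auto

lemma \<sigma>_funpow_mult: "(\<sigma> ^^ i) (x * y) = (\<sigma> ^^ i) x * (\<sigma> ^^ i) y"
  by (induction i) (auto simp: \<sigma>_mult)

lemma \<sigma>_funpow_minus: "(\<sigma> ^^ i) (- x) = - (\<sigma> ^^ i) x"
  by (induction i) (auto simp: \<sigma>_minus)

lemma zero_in_K: "0 \<in> K" and one_in_K: "1 \<in> K"
  by (simp_all flip: fixed_iff)

lemma q_gt_1: "q > 1"
proof -
  have "card {0, 1 :: 'a} \<le> card K"
    using zero_in_K one_in_K by (intro card_mono) auto
  then show ?thesis using card_K by simp
qed

lemma n_pos: "n > 0"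
proof (rule ccontr)
  assume "\<not> n > 0"
  then have "card (UNIV :: 'a set) = 1" using card_UNIV by simp
  moreover have "card {0, 1 :: 'a} \<le> card (UNIV :: 'a set)" by (intro card_mono) auto
  ultimately show False by simp
qed

section \<open>Twisted operators and norms\<close>

definition twist :: "'a \<Rightarrow> 'a \<Rightarrow> 'a" where
  "twist z x = z * \<sigma> x"

text \<open>The skew polynomial with coefficients \<open>a\<close>, evaluated by letting
  \<open>\<sigma>\<close> act as \<open>twist z\<close>. Varying \<open>z\<close> tests the same
  coefficients on every norm class.\<close>

definition sig_op :: "'a \<Rightarrow> (nat \<Rightarrow> 'a) \<Rightarrow> nat \<Rightarrow> 'a \<Rightarrow> 'a" where
  "sig_op z a d x = (\<Sum>i\<le>d. a i * (twist z ^^ i) x)"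

text \<open>The power of \<open>z\<close> with exponent 1 + \<sigma> + ... + \<sigma>^(i-1), as it
  occurs in the projective polynomial; for \<open>i = n\<close> it is the norm to
  \<open>K\<close>.\<close>

definition sig_pow :: "'a \<Rightarrow> nat \<Rightarrow> 'a" where
  "sig_pow z i = (\<Prod>j<i. (\<sigma> ^^ j) z)"

abbreviation Norm :: "'a \<Rightarrow> 'a" where
  "Norm z \<equiv> sig_pow z n"

definition sig_ker :: "'a \<Rightarrow> (nat \<Rightarrow> 'a) \<Rightarrow> nat \<Rightarrow> 'a set" where
  "sig_ker z a d = {x. sig_op z a d x = 0}"

lemma twist_add: "twist z (x + y) = twist z x + twist z y"
  by (simp add: twist_def \<sigma>_add distrib_left)

lemma twist_funpow_0 [simp]: "(twist z ^^ i) 0 = 0"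
  by (induction i) (auto simp: twist_def)

lemma twist_funpow_add: "(twist z ^^ i) (x + y) = (twist z ^^ i) x + (twist z ^^ i) y"
  by (induction i) (auto simp: twist_add)

lemma twist_funpow_diff: "(twist z ^^ i) (x - y) = (twist z ^^ i) x - (twist z ^^ i) y"
  using twist_funpow_add[of i z "x - y" y] by simp

lemma twist_funpow_mult: "(twist z ^^ i) (c * x) = (\<sigma> ^^ i) c * (twist z ^^ i) x"
  by (induction i) (auto simp: twist_def \<sigma>_mult)

lemma twist_funpow_sum: "(twist z ^^ i) (\<Sum>l\<in>A. f l) = (\<Sum>l\<in>A. (twist z ^^ i) (f l))"
  by (induction A rule: infinite_finite_induct) (auto simp: twist_funpow_add)

lemma sig_pow_0 [simp]: "sig_pow z 0 = 1"
  by (simp add: sig_pow_def)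

lemma sig_pow_Suc: "sig_pow z (Suc i) = z * \<sigma> (sig_pow z i)"
proof -
  have "\<sigma> (\<Prod>j<i. (\<sigma> ^^ j) z) = (\<Prod>j<i. (\<sigma> ^^ Suc j) z)"
    by (induction i) (auto simp: \<sigma>_mult)
  then show ?thesis by (simp add: sig_pow_def prod.lessThan_Suc_shift del: prod.lessThan_Suc)
qed

lemma twist_funpow_eq: "(twist z ^^ i) x = sig_pow z i * (\<sigma> ^^ i) x"
  by (induction i) (auto simp: twist_def sig_pow_Suc \<sigma>_mult)

lemma sig_pow_mult: "sig_pow (x * y) i = sig_pow x i * sig_pow y i"
  by (simp add: sig_pow_def \<sigma>_funpow_mult prod.distrib)

lemma sig_pow_1 [simp]: "sig_pow 1 i = 1"
  by (simp add: sig_pow_def)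

lemma sig_pow_eq_0_iff: "z \<noteq> 0 \<Longrightarrow> sig_pow z i \<noteq> 0"
  by (simp add: sig_pow_def)

lemma twist_funpow_n: "(twist z ^^ n) x = Norm z * x"
  by (simp add: twist_funpow_eq \<sigma>_order)

lemma sig_pow_\<sigma>: "sig_pow (\<sigma> x) i = \<sigma> (sig_pow x i)"
  by (induction i) (auto simp: sig_pow_Suc \<sigma>_mult)

lemma Norm_0 [simp]: "Norm 0 = 0"
  using n_pos by (auto simp: gr0_conv_Suc sig_pow_Suc)

lemma Norm_\<sigma>: "Norm (\<sigma> x) = Norm x"
proof (cases "x = 0")
  case False
  \<comment> \<open>Splitting off the last of the \<open>n + 1\<close> conjugates, which is
    \<open>x\<close> again, is compared with splitting off the first.\<close>
  have "sig_pow x (Suc n) = Norm x * x" by (simp add: sig_pow_def \<sigma>_order)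
  then have "x * \<sigma> (Norm x) = x * Norm x" by (simp add: sig_pow_Suc mult.commute)
  then show ?thesis using False by (simp add: sig_pow_\<sigma>)
qed simp

lemma Norm_in_K: "Norm x \<in> K"
  using Norm_\<sigma>[of x] by (simp add: sig_pow_\<sigma> flip: fixed_iff)

lemma Norm_quotient: "x \<noteq> 0 \<Longrightarrow> Norm (z * \<sigma> x / x) = Norm z"
  using sig_pow_mult[of "z * \<sigma> x / x" x n] sig_pow_eq_0_iff[of x n]
  by (simp add: sig_pow_mult Norm_\<sigma>)

text \<open>The conjugates of \<open>\<sigma> x / x\<close> telescope. This links roots of the
  projective polynomial to kernels of twisted operators.\<close>

lemma sig_pow_quotient:
  "x \<noteq> 0 \<Longrightarrow> sig_pow (z * \<sigma> x / x) i = (twist z ^^ i) x / x"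
  by (induction i) (auto simp: sig_pow_Suc twist_def \<sigma>_divide)

lemma sig_op_add: "sig_op z a d (x + y) = sig_op z a d x + sig_op z a d y"
  by (simp add: sig_op_def twist_funpow_add distrib_left sum.distrib)

lemma sig_op_0 [simp]: "sig_op z a d 0 = 0"
  by (simp add: sig_op_def)

lemma card_sig_ker_ge_1: "card (sig_ker z a d) \<ge> 1"
proof -
  have "0 \<in> sig_ker z a d" by (simp add: sig_ker_def)
  then show ?thesis using card_mono[of "sig_ker z a d" "{0}"] by simp
qed

section \<open>Right division and the size of kernels\<close>

text \<open>Right division by \<open>\<sigma> - y\<close>. Quotient \<open>m\<close> and remainder
  \<open>r\<close> depend on neither \<open>z\<close> nor \<open>x\<close>, so a factor found at one
  \<open>z\<close> splits off at all of them.\<close>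

lemma sig_op_division:
  "\<exists>m r. m d = a (Suc d) \<and>
     (\<forall>z x. sig_op z a (Suc d) x = sig_op z m d (twist z x - y * x) + r * x)"
proof (induction d arbitrary: a)
  case 0
  show ?case
    by (rule exI[of _ "\<lambda>_. a 1"], rule exI[of _ "a 0 + a 1 * y"])
      (auto simp: sig_op_def algebra_simps)
next
  case (Suc d)
  \<comment> \<open>Subtracting the leading coefficient times \<sigma>^(d+1) (\<sigma> - y) cancels
    the top term; moving \<open>y\<close> past \<sigma>^(d+1) conjugates it, whence the correction
    one degree lower.\<close>
  define a' where "a' = a(Suc d := a (Suc d) + a (Suc (Suc d)) * (\<sigma> ^^ Suc d) y)"
  obtain m r where m: "\<And>z x. sig_op z a' (Suc d) x = sig_op z m d (twist z x - y * x) + r * x"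
    using Suc[of a'] by blast
  define m' where "m' = m(Suc d := a (Suc (Suc d)))"
  have "sig_op z a (Suc (Suc d)) x = sig_op z m' (Suc d) (twist z x - y * x) + r * x" for z x
  proof -
    let ?t = "a (Suc (Suc d)) * (twist z ^^ Suc d) (twist z x - y * x)"
    have "(\<Sum>i\<le>d. a' i * (twist z ^^ i) x) = (\<Sum>i\<le>d. a i * (twist z ^^ i) x)"
      by (intro sum.cong) (auto simp: a'_def)
    moreover have "(twist z ^^ Suc (Suc d)) x = (twist z ^^ Suc d) (twist z x)"
      by (simp only: funpow_Suc_right o_apply)
    ultimately have "sig_op z a (Suc (Suc d)) x = sig_op z a' (Suc d) x + ?t"
      unfolding sig_op_def twist_funpow_diff twist_funpow_mult
      by (simp add: a'_def algebra_simps del: funpow.simps)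
    moreover have "sig_op z m' (Suc d) w = sig_op z m d w + a (Suc (Suc d)) * (twist z ^^ Suc d) w" for w
    proof -
      have "(\<Sum>i\<le>d. m' i * (twist z ^^ i) w) = (\<Sum>i\<le>d. m i * (twist z ^^ i) w)"
        by (intro sum.cong) (auto simp: m'_def)
      then show ?thesis unfolding sig_op_def by (simp add: m'_def)
    qed
    ultimately show ?thesis using m[of z x] by simp
  qed
  then show ?case by (intro exI[of _ m'] exI[of _ r] conjI allI) (simp add: m'_def)
qed

text \<open>Induction on the degree: a kernel element \<open>x0\<close> at \<open>z0\<close> yields
  a right factor \<open>\<sigma> - y\<close>, which kills at most \<open>q\<close> elements at
  \<open>z0\<close> and only 0 at points of other norm. Each degree thus costs the whole product one
  factor \<open>q\<close>.\<close>

lemma prod_card_sig_ker_le: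
  assumes "finite Z" and "0 \<notin> Z" and "inj_on Norm Z" and "a d \<noteq> 0"
  shows "(\<Prod>z\<in>Z. card (sig_ker z a d)) \<le> q ^ d"
  using assms(4)
proof (induction d arbitrary: a)
  case 0
  then have "sig_ker z a 0 = {0}" for z by (auto simp: sig_ker_def sig_op_def)
  then show ?case by simp
next
  case (Suc d)
  show ?case
  proof (cases "\<exists>z0\<in>Z. \<exists>x0\<in>sig_ker z0 a (Suc d). x0 \<noteq> 0")
    case False
    have "sig_ker z a (Suc d) = {0}" if "z \<in> Z" for z
      using False that by (auto simp: sig_ker_def)
    then have "(\<Prod>z\<in>Z. card (sig_ker z a (Suc d))) = 1" by (intro prod.neutral) auto
    then show ?thesis using q_gt_1 by (metis less_or_eq_imp_le one_le_power)
  next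
    case True
    then obtain z0 x0 where z0: "z0 \<in> Z" and x0: "sig_op z0 a (Suc d) x0 = 0" "x0 \<noteq> 0"
      by (auto simp: sig_ker_def)
    define y where "y = z0 * \<sigma> x0 / x0"
    obtain m r where m: "m d = a (Suc d)"
      "\<And>z x. sig_op z a (Suc d) x = sig_op z m d (twist z x - y * x) + r * x"
      using sig_op_division[of d a y] by blast
    \<comment> \<open>At \<open>z0\<close> both the operator and the divisor annihilate
      \<open>x0\<close>, leaving \<open>r * x0 = 0\<close>.\<close>
    have "r = 0" using m(2)[of z0 x0] x0 by (simp add: y_def twist_def)
    have le: "card (sig_ker z a (Suc d)) \<le> card (sig_ker z m d) * card {x. twist z x - y * x = 0}" for z
    proof -
      have "sig_ker z a (Suc d) = {x. twist z x - y * x \<in> sig_ker z m d}"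
        using m(2) \<open>r = 0\<close> by (auto simp: sig_ker_def)
      then show ?thesis
        by (simp only:) (rule card_vimage_additive_le, auto simp: twist_add algebra_simps)
    qed
    have le1: "card (sig_ker z a (Suc d)) \<le> card (sig_ker z m d)" if "z \<in> Z - {z0}" for z
    proof -
      \<comment> \<open>A nonzero solution would give \<open>y\<close> the norms of both
        \<open>z\<close> and \<open>z0\<close>.\<close>
      have "x = 0" if x: "twist z x - y * x = 0" for x
      proof (rule ccontr)
        assume "x \<noteq> 0"
        with x have "y = z * \<sigma> x / x" by (simp add: twist_def field_simps)
        then have "Norm z = Norm z0"
          using Norm_quotient[of x z] Norm_quotient[of x0 z0] \<open>x \<noteq> 0\<close> x0(2) by (simp add: y_def)
        then show False using assms(3) \<open>z \<in> Z - {z0}\<close> z0 by (auto dest: inj_onD)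
      qed
      then have "{x. twist z x - y * x = 0} = {0}" by (auto simp: twist_def)
      then show ?thesis using le[of z] by simp
    qed
    \<comment> \<open>The solutions at \<open>z0\<close> form part of the line \<open>K x0\<close>,
      because their ratio to \<open>x0\<close> is fixed by \<open>\<sigma>\<close>.\<close>
    have "card {x. twist z0 x - y * x = 0} \<le> card K"
    proof (rule card_inj_on_le[where f = "\<lambda>x. x / x0"])
      have "z0 \<noteq> 0" using z0 assms(2) by auto
      then have "\<sigma> (x / x0) = x / x0" if "twist z0 x - y * x = 0" for x
        using that x0(2) by (simp add: y_def twist_def \<sigma>_divide field_simps)
      then show "(\<lambda>x. x / x0) ` {x. twist z0 x - y * x = 0} \<subseteq> K" by (auto simp: fixed_iff)
    qed (use x0(2) in \<open>auto simp: inj_on_def\<close>)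
    then have le0: "card (sig_ker z0 a (Suc d)) \<le> q * card (sig_ker z0 m d)"
      using le[of z0] card_K by (metis le_trans mult.commute mult_le_mono1)
    have "(\<Prod>z\<in>Z. card (sig_ker z a (Suc d))) =
        card (sig_ker z0 a (Suc d)) * (\<Prod>z\<in>Z - {z0}. card (sig_ker z a (Suc d)))"
      using assms(1) z0 by (simp add: prod.remove)
    also have "\<dots> \<le> q * card (sig_ker z0 m d) * (\<Prod>z\<in>Z - {z0}. card (sig_ker z m d))"
      by (intro mult_le_mono le0 prod_mono) (use le1 in auto)
    also have "\<dots> = q * (\<Prod>z\<in>Z. card (sig_ker z m d))"
      using assms(1) z0 by (simp add: prod.remove)
    also have "\<dots> \<le> q * q ^ d"
      using Suc.IH[of m] m(1) Suc.prems by simp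
    finally show ?thesis by simp
  qed
qed

lemma card_sig_ker_le:
  assumes "z \<noteq> 0" and "a d \<noteq> 0"
  shows "card (sig_ker z a d) \<le> q ^ d"
  using prod_card_sig_ker_le[of "{z}" a d] assms by simp

text \<open>If \<open>m\<close> is the largest index of a nonzero coefficient, there are at most
  \<open>q ^ m < q ^ d\<close> roots. This serves as independence of the powers of
  \<open>twist z\<close>.\<close>

lemma coeff_eq_0_of_many_roots:
  assumes "z \<noteq> 0" and "q ^ d \<le> card {x. (\<Sum>i<d. f i * (twist z ^^ i) x) = 0}" and "i < d"
  shows "f i = 0"
proof (rule ccontr)
  assume "f i \<noteq> 0"
  define m where "m = Max {j. j < d \<and> f j \<noteq> 0}"
  have "m \<in> {j. j < d \<and> f j \<noteq> 0}" unfolding m_def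
    using \<open>f i \<noteq> 0\<close> \<open>i < d\<close> by (intro Max_in) auto
  then have m: "m < d" "f m \<noteq> 0" by auto
  have above: "f j = 0" if "m < j" "j < d" for j
  proof (rule ccontr)
    assume "f j \<noteq> 0"
    then have "j \<le> m" unfolding m_def using that by (intro Max_ge) auto
    then show False using that by simp
  qed
  have "(\<Sum>i<d. f i * (twist z ^^ i) x) = sig_op z f m x" for x
    unfolding sig_op_def using m above by (intro sum.mono_neutral_right) auto
  then have "q ^ d \<le> card (sig_ker z f m)" using assms(2) by (simp add: sig_ker_def)
  also have "\<dots> \<le> q ^ m" using card_sig_ker_le assms(1) m(2) by blast
  finally show False using m(1) q_gt_1 by (simp add: power_increasing_iff)
qed

section \<open>Hilbert 90 and surjectivity of the norm\<close>

text \<open>A nonzero resolvent, the sum of the \<open>(twist c ^^ i) t\<close> over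
  \<open>i < n\<close>, is fixed by \<open>twist c\<close>; its inverse is the witness.\<close>

lemma Hilbert90:
  assumes "Norm c = 1"
  obtains x where "x \<noteq> 0" and "c = \<sigma> x / x"
proof -
  have "c \<noteq> 0" using assms by auto
  \<comment> \<open>All coefficients of the resolvent are 1, so it cannot vanish on the whole
    field.\<close>
  have "card {t. (\<Sum>i<n. 1 * (twist c ^^ i) t) = 0} < q ^ n"
    using coeff_eq_0_of_many_roots[of c n "\<lambda>_. 1" 0] \<open>c \<noteq> 0\<close> n_pos
    by (metis not_le one_neq_zero)
  then have "{t. (\<Sum>i<n. (twist c ^^ i) t) = 0} \<noteq> UNIV" using card_UNIV by auto
  then obtain t where t: "(\<Sum>i<n. (twist c ^^ i) t) \<noteq> 0" by auto
  define x where "x = (\<Sum>i<n. (twist c ^^ i) t)"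
  have "twist c x = (\<Sum>i<n. (twist c ^^ Suc i) t)"
    unfolding x_def using twist_funpow_sum[of 1 c "\<lambda>i. (twist c ^^ i) t" "{..<n}"] by simp
  \<comment> \<open>Applying \<open>twist c\<close> trades the summand \<open>t\<close> for
    \<open>(twist c ^^ n) t\<close>, which is \<open>t\<close> again because \<open>c\<close> has
    norm 1.\<close>
  moreover have "t + (\<Sum>i<n. (twist c ^^ Suc i) t) = x + (twist c ^^ n) t"
    unfolding x_def using sum.lessThan_Suc_shift[of "\<lambda>i. (twist c ^^ i) t" n]
    by (simp add: add.commute)
  ultimately have "c * \<sigma> x = x" using assms by (simp add: twist_funpow_n twist_def)
  then have "c = \<sigma> (inverse x) / inverse x"
    using t by (simp add: x_def[symmetric] \<sigma>_inverse) (simp add: field_simps)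
  then show thesis using t x_def by (intro that[of "inverse x"]) auto
qed

text \<open>Equal quotients mean that \<open>x / x0\<close> is fixed by \<open>\<sigma>\<close>, so
  the fibre is a coset of \<open>K - {0}\<close>.\<close>

lemma card_same_quotient:
  assumes "x0 \<noteq> 0" and "z \<noteq> 0"
  shows "card {x. x \<noteq> 0 \<and> z * \<sigma> x / x = z * \<sigma> x0 / x0} = q - 1"
proof -
  have "z * \<sigma> x / x = z * \<sigma> x0 / x0 \<longleftrightarrow> x / x0 \<in> K" if "x \<noteq> 0" for x
    using assms that by (auto simp: \<sigma>_divide field_simps simp flip: fixed_iff)
  then have "bij_betw (\<lambda>x. x / x0) {x. x \<noteq> 0 \<and> z * \<sigma> x / x = z * \<sigma> x0 / x0} (K - {0})"
    using assms(1) by (intro bij_betwI[where g = "\<lambda>x. x * x0"]) auto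
  then show ?thesis using zero_in_K card_K by (simp add: bij_betw_same_card)
qed

lemma Norm_eq_imp_quotient:
  assumes "Norm y = Norm z" and "z \<noteq> 0"
  obtains x where "x \<noteq> 0" and "y = z * \<sigma> x / x"
proof -
  have "Norm (y / z) = 1"
    using sig_pow_mult[of "y / z" z n] assms sig_pow_eq_0_iff[of z n] by simp
  then obtain x where "x \<noteq> 0" "y / z = \<sigma> x / x" using Hilbert90 by blast
  then show thesis using assms(2) that[of x] by (simp add: field_simps)
qed

text \<open>By Hilbert 90 the map sending \<open>x\<close> to \<open>\<sigma> x / x\<close> covers
  the norm-one group with fibres of size \<open>q - 1\<close>. Comparing with the fibres of
  \<open>Norm\<close>, which are cosets of that group, gives \<open>q - 1\<close> norms, hence all
  of \<open>K - {0}\<close>.\<close>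

lemma Norm_surj:
  assumes "l \<in> K" and "l \<noteq> 0"
  shows "\<exists>z. z \<noteq> 0 \<and> Norm z = l"
proof -
  let ?U = "{x :: 'a. x \<noteq> 0}" and ?N = "{y. Norm y = 1}"
  have N0: "y \<noteq> 0" if "y \<in> ?N" for y
    using that by auto
  have "card ?U = (q - 1) * card ?N"
  proof (rule card_fibres)
    show image: "(\<lambda>x. 1 * \<sigma> x / x) ` ?U = ?N"
    proof (intro equalityI subsetI)
      fix y assume "y \<in> ?N"
      then obtain x where "x \<noteq> 0" "y = \<sigma> x / x" using Hilbert90 by blast
      then show "y \<in> (\<lambda>x. 1 * \<sigma> x / x) ` ?U" by (intro image_eqI[of _ _ x]) auto
    next
      fix y assume "y \<in> (\<lambda>x. 1 * \<sigma> x / x) ` ?U"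
      then obtain x where "x \<noteq> 0" "y = 1 * \<sigma> x / x" by blast
      then show "y \<in> ?N" using Norm_quotient[of x 1] by simp
    qed
    show "card {x \<in> ?U. 1 * \<sigma> x / x = y} = q - 1" if y: "y \<in> ?N" for y
    proof -
      obtain x0 where x0: "x0 \<noteq> 0" "y = \<sigma> x0 / x0" using y Hilbert90 by blast
      have "card {x. x \<noteq> 0 \<and> 1 * \<sigma> x / x = 1 * \<sigma> x0 / x0} = q - 1"
        using x0(1) by (rule card_same_quotient) simp
      then show ?thesis unfolding x0(2) mult_1 mem_Collect_eq .
    qed
  qed simp
  moreover have "card ?U = card ?N * card (Norm ` ?U)"
  proof (rule card_fibres)
    fix b assume "b \<in> Norm ` ?U"
    then obtain y where y: "y \<noteq> 0" "b = Norm y" by auto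
    have "Norm (x / y) = 1 \<longleftrightarrow> Norm x = b" for x
      using sig_pow_mult[of "x / y" y n] y sig_pow_eq_0_iff[of y n] by auto
    then have "bij_betw (\<lambda>x. x / y) {x \<in> ?U. Norm x = b} ?N"
      using y N0 by (intro bij_betwI[where g = "\<lambda>x. x * y"]) (auto simp: sig_pow_mult)
    then show "card {x \<in> ?U. Norm x = b} = card ?N" by (rule bij_betw_same_card)
  qed auto
  moreover have "card ?N > 0"
    using sig_pow_1[of n] by (metis (mono_tags) card_gt_0_iff empty_iff finite mem_Collect_eq)
  ultimately have "card (Norm ` ?U) = card (K - {0})"
    using card_K zero_in_K sig_pow_1[of n] by (auto simp: mult.commute)
  moreover have "Norm ` ?U \<subseteq> K - {0}" using Norm_in_K sig_pow_eq_0_iff by auto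
  ultimately have "Norm ` ?U = K - {0}" by (intro card_subset_eq) auto
  then have "l \<in> Norm ` ?U" using assms by simp
  then show ?thesis by blast
qed

section \<open>Roots of the projective polynomial, sorted by norm\<close>

definition proj_eval :: "(nat \<Rightarrow> 'a) \<Rightarrow> nat \<Rightarrow> 'a \<Rightarrow> 'a" where
  "proj_eval a d y = (\<Sum>i\<le>d. a i * sig_pow y i)"

lemma proj_eval_quotient:
  "x \<noteq> 0 \<Longrightarrow> proj_eval a d (z * \<sigma> x / x) = sig_op z a d x / x"
  by (simp add: proj_eval_def sig_op_def sig_pow_quotient sum_divide_distrib)

text \<open>Nonzero kernel elements map onto these roots by \<open>z * \<sigma> x / x\<close>,
  surjectively by Hilbert 90 and with fibres of size \<open>q - 1\<close>.\<close>

lemma card_proj_roots_of_Norm: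
  assumes "z \<noteq> 0"
  shows "(q - 1) * card {y. proj_eval a d y = 0 \<and> Norm y = Norm z} = card (sig_ker z a d) - 1"
proof -
  let ?A = "sig_ker z a d - {0}" and ?R = "{y. proj_eval a d y = 0 \<and> Norm y = Norm z}"
  have "card ?A = (q - 1) * card ?R"
  proof (rule card_fibres)
    show image: "(\<lambda>x. z * \<sigma> x / x) ` ?A = ?R"
    proof (intro equalityI subsetI)
      fix y assume "y \<in> ?R"
      then obtain x where x: "x \<noteq> 0" "y = z * \<sigma> x / x"
        using Norm_eq_imp_quotient assms by (metis (mono_tags, lifting) mem_Collect_eq)
      with \<open>y \<in> ?R\<close> have "x \<in> ?A" by (auto simp: proj_eval_quotient sig_ker_def)
      with x show "y \<in> (\<lambda>x. z * \<sigma> x / x) ` ?A" by blast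
    next
      fix y assume "y \<in> (\<lambda>x. z * \<sigma> x / x) ` ?A"
      then obtain x where "x \<noteq> 0" "sig_op z a d x = 0" "y = z * \<sigma> x / x"
        by (auto simp: sig_ker_def)
      then show "y \<in> ?R" using proj_eval_quotient[of x a d z] Norm_quotient[of x z] by simp
    qed
    fix y assume y: "y \<in> ?R"
    then obtain x0 where x0: "x0 \<noteq> 0" "y = z * \<sigma> x0 / x0" using image by auto
    \<comment> \<open>Whether a nonzero \<open>x\<close> lies in the kernel depends only on its
      quotient, so the whole fibre does.\<close>
    have "{x \<in> ?A. z * \<sigma> x / x = y} = {x. x \<noteq> 0 \<and> z * \<sigma> x / x = y}"
      using y proj_eval_quotient[of _ a d z] by (auto simp: sig_ker_def)
    then show "card {x \<in> ?A. z * \<sigma> x / x = y} = q - 1"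
      using card_same_quotient[OF x0(1) assms] x0(2) by simp
  qed simp
  moreover have "0 \<in> sig_ker z a d" by (simp add: sig_ker_def)
  ultimately show ?thesis by simp
qed

lemma card_proj_roots_eq_iff:
  assumes "a d \<noteq> 0" and "a 0 \<noteq> 0" and "d \<ge> 1"
  shows "card {y. proj_eval a d y = 0} = (q ^ d - 1) div (q - 1) \<longleftrightarrow>
    (\<exists>z. z \<noteq> 0 \<and> card (sig_ker z a d) = q ^ d)"
proof -
  let ?R = "{y. proj_eval a d y = 0}"
  \<comment> \<open>\<open>f\<close> picks one representative of each norm class.\<close>
  have "\<exists>f. \<forall>l\<in>K - {0}. f l \<noteq> 0 \<and> Norm (f l) = l"
    using Norm_surj by (intro bchoice) auto
  then obtain f where f: "\<And>l. l \<in> K - {0} \<Longrightarrow> f l \<noteq> 0 \<and> Norm (f l) = l" by blast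
  define k where "k l = card (sig_ker (f l) a d)" for l
  \<comment> \<open>As \<open>a 0 \<noteq> 0\<close>, this excludes 0 as a root, so every root has
    its norm in \<open>K - {0}\<close>.\<close>
  have "proj_eval a d 0 = a 0"
  proof -
    have "proj_eval a d 0 = (\<Sum>i\<in>{0}. a i * sig_pow 0 i)" unfolding proj_eval_def
      by (rule sum.mono_neutral_right) (auto simp: gr0_conv_Suc sig_pow_Suc)
    then show ?thesis by simp
  qed
  then have R0: "y \<noteq> 0" if "y \<in> ?R" for y using that assms(2) by auto
  have "card ?R = (\<Sum>l\<in>K - {0}. card {y. proj_eval a d y = 0 \<and> Norm y = l})"
  proof -
    have "?R = (\<Union>l\<in>K - {0}. {y. proj_eval a d y = 0 \<and> Norm y = l})"
      using R0 Norm_in_K sig_pow_eq_0_iff by auto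
    then show ?thesis by (simp only:) (rule card_UN_disjoint, auto)
  qed
  then have "(q - 1) * card ?R =
      (\<Sum>l\<in>K - {0}. (q - 1) * card {y. proj_eval a d y = 0 \<and> Norm y = l})"
    by (simp add: sum_distrib_left)
  also have "\<dots> = (\<Sum>l\<in>K - {0}. k l - 1)"
    unfolding k_def
  proof (intro sum.cong refl)
    fix l assume "l \<in> K - {0}"
    then show "(q - 1) * card {y. proj_eval a d y = 0 \<and> Norm y = l} = card (sig_ker (f l) a d) - 1"
      using card_proj_roots_of_Norm[of "f l" a d] f by metis
  qed
  finally have sum: "(q - 1) * card ?R = (\<Sum>l\<in>K - {0}. k l - 1)" .
  have inj: "inj_on f (K - {0})" using f by (metis inj_onI)
  have "(\<Prod>l\<in>K - {0}. k l) = (\<Prod>z\<in>f ` (K - {0}). card (sig_ker z a d))"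
    unfolding k_def by (simp add: prod.reindex[OF inj])
  also have "\<dots> \<le> q ^ d"
  proof (rule prod_card_sig_ker_le)
    show "0 \<notin> f ` (K - {0})" using f by force
    show "inj_on Norm (f ` (K - {0}))" using f by (auto simp: inj_on_def)
  qed (use assms in auto)
  finally have prod: "(\<Prod>l\<in>K - {0}. k l) \<le> q ^ d" .
  \<comment> \<open>Exactness of the division allows the count to be multiplied through by
    \<open>q - 1\<close>.\<close>
  have "q - 1 dvd q ^ d - 1"
  proof -
    have "int q - 1 dvd int q ^ d - 1" by (rule power_diff_1_eq[THEN dvdI])
    then have "int (q - 1) dvd int (q ^ d - 1)" using q_gt_1 by (simp add: of_nat_diff)
    then show ?thesis by (simp only: of_nat_dvd_iff)
  qed
  then have "card ?R = (q ^ d - 1) div (q - 1) \<longleftrightarrow> (q - 1) * card ?R = q ^ d - 1"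
    using q_gt_1 by auto
  also have "\<dots> \<longleftrightarrow> (\<exists>l\<in>K - {0}. k l = q ^ d)"
    unfolding sum
  proof (rule sum_pred_eq_iff_of_prod_le)
    show "q ^ d > 1" using q_gt_1 assms(3) by (intro one_less_power) auto
  qed (use prod card_sig_ker_ge_1 in \<open>auto simp: k_def simp del: One_nat_def\<close>)
  also have "\<dots> \<longleftrightarrow> (\<exists>z. z \<noteq> 0 \<and> card (sig_ker z a d) = q ^ d)"
  proof
    assume "\<exists>l\<in>K - {0}. k l = q ^ d"
    then show "\<exists>z. z \<noteq> 0 \<and> card (sig_ker z a d) = q ^ d" using f by (auto simp: k_def)
  next
    assume "\<exists>z. z \<noteq> 0 \<and> card (sig_ker z a d) = q ^ d"
    then obtain z where z: "z \<noteq> 0" "card (sig_ker z a d) = q ^ d" by blast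
    then have l: "Norm z \<in> K - {0}" using Norm_in_K sig_pow_eq_0_iff by auto
    \<comment> \<open>\<open>z\<close> and the representative of its norm count the same roots, so
      their kernels have equal size.\<close>
    have "k (Norm z) - 1 = card (sig_ker z a d) - 1" unfolding k_def
      using card_proj_roots_of_Norm[of z a d] card_proj_roots_of_Norm[of "f (Norm z)" a d] f[OF l] z
      by simp
    then have "k (Norm z) = q ^ d"
      using z(2) card_sig_ker_ge_1[of z a d] card_sig_ker_ge_1[of "f (Norm z)" a d]
      unfolding k_def by linarith
    then show "\<exists>l\<in>K - {0}. k l = q ^ d" using l by blast
  qed
  finally show ?thesis .
qed

section \<open>Remainders modulo \<open>L\<close> and the companion matrix\<close>

text \<open>For \<open>i < d\<close> this is the coefficient of \<open>\<sigma>\<^sup>i\<close> in the remainder of \<open>\<sigma>\<^sup>m\<close> modulo the monic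
  operator \<open>L\<close> with lower coefficients \<open>b\<close>; for \<open>i \<ge> d\<close> it is the coefficient of \<open>\<sigma>\<^bsup>i-d\<^esup>\<close> in the
  quotient.\<close>

function rec_coeff :: "(nat \<Rightarrow> 'a) \<Rightarrow> nat \<Rightarrow> nat \<Rightarrow> nat \<Rightarrow> 'a" where
  "rec_coeff b d m i = of_bool (m = i) -
     (if m < d then 0 else \<Sum>l<d. (\<sigma> ^^ (m - d)) (b l) * rec_coeff b d (m - d + l) i)"
  by auto
termination by (relation "measure (\<lambda>(b, d, m, i). m)") auto

declare rec_coeff.simps [simp del]

lemma rec_coeff_less: "m < d \<Longrightarrow> rec_coeff b d m i = of_bool (m = i)"
  by (simp add: rec_coeff.simps)

lemma rec_coeff_add: "rec_coeff b d (k + d) i = of_bool (k + d = i) -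
    (\<Sum>l<d. (\<sigma> ^^ k) (b l) * rec_coeff b d (k + l) i)"
  by (subst rec_coeff.simps) simp

lemma rec_coeff_above: "m < i \<Longrightarrow> rec_coeff b d m i = 0"
proof (induction m rule: less_induct)
  case (less m)
  then show ?case by (subst rec_coeff.simps) (auto intro!: sum.neutral)
qed

lemma rec_coeff_diag: "rec_coeff b d m m = 1"
  by (subst rec_coeff.simps) (auto intro!: sum.neutral rec_coeff_above)

text \<open>Division with remainder, evaluated at \<open>x\<close>: indices below \<open>d\<close>
  give the remainder, the others apply the quotient to the value of the monic operator. The common
  bound \<open>M\<close> lets all \<open>m\<close> in the induction share one index set.\<close>

lemma twist_funpow_eq_rec_coeff:
  assumes "m \<le> M"
  shows "(twist z ^^ m) x = (\<Sum>i\<le>M. rec_coeff b d m i *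
    (if i < d then (twist z ^^ i) x
     else (twist z ^^ (i - d)) ((twist z ^^ d) x + (\<Sum>l<d. b l * (twist z ^^ l) x))))"
    (is "_ = (\<Sum>i\<le>M. _ * ?Y i)")
  using assms
proof (induction m rule: less_induct)
  case (less m)
  have Y: "(\<Sum>i\<le>M. of_bool (m = i) * ?Y i) = ?Y m"
    using less.prems by (simp add: of_bool_def if_distrib[of "\<lambda>t. t * _"] sum.delta' cong: if_cong)
  show ?case
  proof (cases "m < d")
    case True
    then show ?thesis using Y by (simp add: rec_coeff_less)
  next
    case False
    then obtain k where m: "m = k + d" by (metis add.commute le_Suc_ex not_less)
    have "(\<Sum>i\<le>M. rec_coeff b d m i * ?Y i) =
        ?Y m - (\<Sum>i\<le>M. \<Sum>l<d. (\<sigma> ^^ k) (b l) * rec_coeff b d (k + l) i * ?Y i)"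
      unfolding Y[symmetric] unfolding m rec_coeff_add left_diff_distrib sum_subtractf sum_distrib_right
      by (rule refl)
    also have "(\<Sum>i\<le>M. \<Sum>l<d. (\<sigma> ^^ k) (b l) * rec_coeff b d (k + l) i * ?Y i) =
        (\<Sum>l<d. (\<sigma> ^^ k) (b l) * (\<Sum>i\<le>M. rec_coeff b d (k + l) i * ?Y i))"
      by (subst sum.swap) (simp only: sum_distrib_left mult.assoc)
    also have "\<dots> = (\<Sum>l<d. (\<sigma> ^^ k) (b l) * (twist z ^^ (k + l)) x)"
      by (intro sum.cong refl arg_cong2[where f = "(*)"] less.IH[symmetric]) (use less.prems m in auto)
    \<comment> \<open>\<open>?Y m\<close> is \<open>twist z ^^ k\<close> of the monic operator at
      \<open>x\<close>; the subtracted sum is its part from the lower coefficients.\<close>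
    also have "?Y m - \<dots> = (twist z ^^ m) x"
      by (simp add: m twist_funpow_add twist_funpow_sum twist_funpow_mult Nat.funpow_add)
    finally show ?thesis by simp
  qed
qed

lemma sig_op_monic:
  assumes "a d \<noteq> 0"
  shows "(twist z ^^ d) x + (\<Sum>l<d. a l / a d * (twist z ^^ l) x) = sig_op z a d x / a d"
proof -
  have "sig_op z a d x = (\<Sum>l<d. a l * (twist z ^^ l) x) + a d * (twist z ^^ d) x"
    by (simp add: sig_op_def flip: lessThan_Suc_atMost)
  then show ?thesis using assms by (simp add: add_divide_distrib sum_divide_distrib)
qed

lemma twisted_prod_Suc:
  "twisted_prod \<sigma> (Suc k) d a = twisted_prod \<sigma> k d a * map_mat (\<sigma> ^^ k) (companion d a)"
proof -
  have C: "map_mat (\<sigma> ^^ l) (companion d a) \<in> carrier_mat d d" for l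
    by (simp add: companion_def)
  have foldr: "foldr (*) (map (\<lambda>k. map_mat (\<sigma> ^^ k) (companion d a)) xs) M =
      foldr (*) (map (\<lambda>k. map_mat (\<sigma> ^^ k) (companion d a)) xs) (1\<^sub>m d) * M \<and>
      foldr (*) (map (\<lambda>k. map_mat (\<sigma> ^^ k) (companion d a)) xs) (1\<^sub>m d) \<in> carrier_mat d d"
    if M: "M \<in> carrier_mat d d" for xs M
  proof (induction xs)
    case (Cons l xs)
    then show ?case using C[of l] M by (auto simp: assoc_mult_mat[OF C _ M])
  qed (use M in auto)
  have "twisted_prod \<sigma> (Suc k) d a =
      foldr (*) (map (\<lambda>k. map_mat (\<sigma> ^^ k) (companion d a)) [0..<k])
        (map_mat (\<sigma> ^^ k) (companion d a))"
    using C[of k] by (simp add: twisted_prod_def)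
  then show ?thesis unfolding twisted_prod_def[of \<sigma> k] using foldr[OF C] by metis
qed

text \<open>Right multiplication by the next conjugate of the companion matrix shifts the columns
  one place left and fills the last by the recursion, so the columns stay consecutive
  remainders.\<close>

lemma twisted_prod_eq:
  "twisted_prod \<sigma> k d a = mat d d (\<lambda>(i, j). rec_coeff (\<lambda>l. a l / a d) d (k + j) i)"
proof (induction k)
  case 0
  show ?case by (rule eq_matI) (auto simp: twisted_prod_def rec_coeff_less)
next
  case (Suc k)
  let ?c = "rec_coeff (\<lambda>l. a l / a d) d"
  show ?case unfolding twisted_prod_Suc Suc.IH
  proof (rule eq_matI)
    fix i j assume "i < dim_row (mat d d (\<lambda>(i, j). ?c (Suc k + j) i))"
      and "j < dim_col (mat d d (\<lambda>(i, j). ?c (Suc k + j) i))"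
    then have ij: "i < d" "j < d" by auto
    have "(mat d d (\<lambda>(i, j). ?c (k + j) i) * map_mat (\<sigma> ^^ k) (companion d a)) $$ (i, j) =
        (\<Sum>l<d. ?c (k + l) i * (\<sigma> ^^ k) (companion d a $$ (l, j)))"
      using ij by (simp add: scalar_prod_def companion_def atLeast0LessThan)
    also have "\<dots> = ?c (Suc k + j) i"
    proof (cases "j = d - 1")
      case True
      then have "Suc k + j = k + d" using ij by simp
      then show ?thesis using True ij
        by (simp only: rec_coeff_add)
          (simp add: companion_def \<sigma>_funpow_minus sum_negf mult.commute)
    next
      case False
      then have "(\<Sum>l<d. ?c (k + l) i * (\<sigma> ^^ k) (companion d a $$ (l, j))) =
          (\<Sum>l<d. if l = Suc j then ?c (k + l) i else 0)"
        using ij by (intro sum.cong) (auto simp: companion_def)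
      then show ?thesis using False ij by (simp add: sum.delta)
    qed
    finally show "(mat d d (\<lambda>(i, j). ?c (k + j) i) * map_mat (\<sigma> ^^ k) (companion d a)) $$ (i, j) =
        mat d d (\<lambda>(i, j). ?c (Suc k + j) i) $$ (i, j)"
      using ij by simp
  qed (auto simp: companion_def)
qed

lemma twisted_prod_eq_scalar_iff:
  "twisted_prod \<sigma> k d a = l \<cdot>\<^sub>m 1\<^sub>m d \<longleftrightarrow>
    (\<forall>i<d. \<forall>j<d. rec_coeff (\<lambda>l. a l / a d) d (k + j) i = l * of_bool (i = j))"
  unfolding twisted_prod_eq by (auto simp: mat_eq_iff)

section \<open>Full kernels and scalar matrices\<close>

lemma card_sig_ker_eq_iff:
  assumes z: "z \<noteq> 0" and d: "d \<ge> 1" and ad: "a d \<noteq> 0"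
  shows "card (sig_ker z a d) = q ^ d \<longleftrightarrow> twisted_prod \<sigma> n d a = Norm z \<cdot>\<^sub>m 1\<^sub>m d"
proof
  let ?c = "rec_coeff (\<lambda>l. a l / a d) d"
  assume card: "card (sig_ker z a d) = q ^ d"
  have "?c (n + j) i - Norm z * of_bool (i = j) = 0" if "i < d" "j < d" for i j
  proof (rule coeff_eq_0_of_many_roots[OF z _ \<open>i < d\<close>])
    have "(\<Sum>i<d. (?c (n + j) i - Norm z * of_bool (i = j)) * (twist z ^^ i) x) = 0"
      if x: "x \<in> sig_ker z a d" for x
    proof -
      \<comment> \<open>The bound \<open>n + j + d\<close> ensures that the range contains every
        index below \<open>d\<close>, even when \<open>n + j < d\<close>.\<close>
      have "(twist z ^^ (n + j)) x = (\<Sum>i\<le>n + j + d. ?c (n + j) i *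
          (if i < d then (twist z ^^ i) x else (twist z ^^ (i - d)) (sig_op z a d x / a d)))"
        using twist_funpow_eq_rec_coeff[of "n + j" "n + j + d" z x "\<lambda>l. a l / a d" d]
        by (simp only: sig_op_monic[where a = a, OF ad])
      also have "\<dots> = (\<Sum>i<d. ?c (n + j) i *
          (if i < d then (twist z ^^ i) x else (twist z ^^ (i - d)) (sig_op z a d x / a d)))"
        using x by (intro sum.mono_neutral_right) (auto simp: sig_ker_def)
      finally have "(twist z ^^ (n + j)) x = (\<Sum>i<d. ?c (n + j) i * (twist z ^^ i) x)" by simp
      moreover have "(twist z ^^ (n + j)) x = Norm z * (twist z ^^ j) x"
        by (simp add: Nat.funpow_add twist_funpow_n)
      moreover have "(\<Sum>i<d. Norm z * of_bool (i = j) * (twist z ^^ i) x) = Norm z * (twist z ^^ j) x"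
      proof -
        have "(\<Sum>i<d. Norm z * of_bool (i = j) * (twist z ^^ i) x) =
            (\<Sum>i<d. if i = j then Norm z * (twist z ^^ i) x else 0)"
          by (intro sum.cong) auto
        then show ?thesis using \<open>j < d\<close> by simp
      qed
      ultimately show ?thesis by (simp add: left_diff_distrib sum_subtractf)
    qed
    then have "sig_ker z a d \<subseteq>
        {x. (\<Sum>i<d. (?c (n + j) i - Norm z * of_bool (i = j)) * (twist z ^^ i) x) = 0}" by blast
    then show "q ^ d \<le> card {x. (\<Sum>i<d. (?c (n + j) i - Norm z * of_bool (i = j)) * (twist z ^^ i) x) = 0}"
      unfolding card[symmetric] by (intro card_mono finite)
  qed
  then show "twisted_prod \<sigma> n d a = Norm z \<cdot>\<^sub>m 1\<^sub>m d"
    by (simp add: twisted_prod_eq_scalar_iff)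
next
  let ?c = "rec_coeff (\<lambda>l. a l / a d) d"
  assume "twisted_prod \<sigma> n d a = Norm z \<cdot>\<^sub>m 1\<^sub>m d"
  then have scalar: "\<forall>i<d. \<forall>j<d. ?c (n + j) i = Norm z * of_bool (i = j)"
    unfolding twisted_prod_eq_scalar_iff .
  have c: "?c n i = Norm z * of_bool (i = 0)" if "i < d" for i
    using scalar[rule_format, of i 0] that d by simp
  \<comment> \<open>If \<open>n < d\<close>, then \<sigma>^n is its own remainder and has
    coefficient 1 at index \<open>n > 0\<close>, where the scalar matrix demands 0.\<close>
  have "d \<le> n"
  proof (rule ccontr)
    assume "\<not> d \<le> n"
    then show False using c[of n] n_pos rec_coeff_diag[of _ d n] by auto
  qed
  then obtain e where n: "n = e + d" by (metis add.commute le_Suc_ex)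
  \<comment> \<open>The coefficients of the quotient of \<sigma>^n by the monic \<open>L\<close>;
    its degree is \<open>e = n - d\<close> and its leading coefficient 1.\<close>
  define g where "g j = ?c n (j + d)" for j
  have range: "sig_op z g e (sig_op z a d x / a d) = 0" for x
  proof -
    let ?Y = "\<lambda>i. if i < d then (twist z ^^ i) x else (twist z ^^ (i - d)) (sig_op z a d x / a d)"
    have "Norm z * x = (\<Sum>i\<le>n. ?c n i * ?Y i)"
      using twist_funpow_eq_rec_coeff[of n n z x "\<lambda>l. a l / a d" d]
      by (simp only: sig_op_monic[where a = a, OF ad] twist_funpow_n)
    also have "\<dots> = (\<Sum>i<d. ?c n i * ?Y i) + (\<Sum>i\<in>{d..n}. ?c n i * ?Y i)"
      using \<open>d \<le> n\<close> by (subst sum.union_disjoint[symmetric]) (auto intro!: sum.cong)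
    also have "(\<Sum>i<d. ?c n i * ?Y i) = (\<Sum>i<d. if i = 0 then Norm z * x else 0)"
      by (intro sum.cong) (auto simp: c)
    also have "\<dots> = Norm z * x" using d by simp
    also have "(\<Sum>i\<in>{d..n}. ?c n i * ?Y i) = sig_op z g e (sig_op z a d x / a d)"
      unfolding sig_op_def[of z g] g_def
      by (rule sum.reindex_bij_witness[of _ "\<lambda>i. i + d" "\<lambda>i. i - d"]) (auto simp: n)
    finally show ?thesis by simp
  qed
  define h where "h x = sig_op z a d x / a d" for x
  have h_add: "h (x + y) = h x + h y" for x y
    by (simp add: h_def sig_op_add add_divide_distrib)
  have "g e \<noteq> 0" unfolding g_def n[symmetric] rec_coeff_diag by simp
  \<comment> \<open>The image of \<open>h\<close> lies in a kernel of at most \<open>q ^ e\<close>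
    elements, which forces the kernel of \<open>h\<close> to have at least
    \<open>q ^ d\<close>.\<close>
  have "{x. h x \<in> sig_ker z g e} = UNIV" using range by (simp add: sig_ker_def h_def)
  then have "q ^ n = card {x. h x \<in> sig_ker z g e}" using card_UNIV by simp
  also have "\<dots> \<le> card (sig_ker z g e) * card {x. h x = 0}"
    using h_add by (intro card_vimage_additive_le) simp_all
  also have "\<dots> \<le> q ^ e * card {x. h x = 0}"
    using card_sig_ker_le[of z g e] z \<open>g e \<noteq> 0\<close> by (intro mult_le_mono1) blast
  also have "{x. h x = 0} = sig_ker z a d" using ad by (auto simp: h_def sig_ker_def)
  finally have "q ^ e * q ^ d \<le> q ^ e * card (sig_ker z a d)" unfolding n power_add .
  then have "q ^ d \<le> card (sig_ker z a d)" using q_gt_1 by simp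
  then show "card (sig_ker z a d) = q ^ d" using card_sig_ker_le[of z a d] z ad by simp
qed

text \<open>The recursion can be run backwards because \<open>a 0 \<noteq> 0\<close>:
  \<open>d\<close> consecutive vanishing constant coefficients would descend to index 0, where the
  value is 1.\<close>

lemma twisted_prod_ne_0:
  assumes "d \<ge> 1" and "a d \<noteq> 0" and "a 0 \<noteq> 0"
  shows "twisted_prod \<sigma> k d a \<noteq> 0 \<cdot>\<^sub>m 1\<^sub>m d"
proof
  let ?c = "rec_coeff (\<lambda>l. a l / a d) d"
  assume "twisted_prod \<sigma> k d a = 0 \<cdot>\<^sub>m 1\<^sub>m d"
  then have "?c (k + j) 0 = 0" if "j < d" for j
    using that assms(1) by (simp add: twisted_prod_eq_scalar_iff)
  then have "?c (0 + 0) 0 = 0" using assms(1)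
  proof (induction k)
    case (Suc k)
    have shifted: "?c (k + l) 0 = 0" if "0 < l" "l \<le> d" for l
      using Suc.prems(1)[of "l - 1"] that by simp
    \<comment> \<open>The values at \<open>k + 1\<close> to \<open>k + d\<close> already vanish, so
      the recursion for \<open>k + d\<close> isolates the one at \<open>k\<close>.\<close>
    have "(\<Sum>l<d. (\<sigma> ^^ k) (a l / a d) * ?c (k + l) 0) =
        (\<Sum>l\<in>{0}. (\<sigma> ^^ k) (a l / a d) * ?c (k + l) 0)"
      using assms(1) by (intro sum.mono_neutral_right) (auto simp: shifted)
    then have "(\<sigma> ^^ k) (a 0 / a d) * ?c k 0 = 0"
      using rec_coeff_add[of "\<lambda>l. a l / a d" d k 0] shifted[of d] assms(1) by simp
    then have "?c (k + 0) 0 = 0" using assms by simp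
    then have "?c (k + j) 0 = 0" if "j < d" for j
      using shifted[of j] that by (cases "j = 0") auto
    then show ?case using Suc.IH assms(1) by blast
  qed auto
  then show False using rec_coeff_diag[of _ d 0] by simp
qed

text \<open>The scalar is nonzero, hence a norm, so it is covered by the criterion for a suitable
  \<open>z\<close>.\<close>

lemma twisted_prod_scalar_iff_card_sig_ker:
  assumes "d \<ge> 1" and "a d \<noteq> 0" and "a 0 \<noteq> 0"
  shows "(\<exists>l\<in>K. twisted_prod \<sigma> n d a = l \<cdot>\<^sub>m 1\<^sub>m d) \<longleftrightarrow>
    (\<exists>z. z \<noteq> 0 \<and> card (sig_ker z a d) = q ^ d)"
proof
  assume "\<exists>l\<in>K. twisted_prod \<sigma> n d a = l \<cdot>\<^sub>m 1\<^sub>m d"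
  then obtain l where l: "l \<in> K" "twisted_prod \<sigma> n d a = l \<cdot>\<^sub>m 1\<^sub>m d" by blast
  then have "l \<noteq> 0" using twisted_prod_ne_0[of d a n] assms by blast
  then obtain z where z: "z \<noteq> 0" "Norm z = l" using Norm_surj l(1) by blast
  then have "card (sig_ker z a d) = q ^ d" using card_sig_ker_eq_iff[of z d a] assms l(2) by blast
  with z show "\<exists>z. z \<noteq> 0 \<and> card (sig_ker z a d) = q ^ d" by blast
next
  assume "\<exists>z. z \<noteq> 0 \<and> card (sig_ker z a d) = q ^ d"
  then obtain z where "z \<noteq> 0" "card (sig_ker z a d) = q ^ d" by blast
  then have "twisted_prod \<sigma> n d a = Norm z \<cdot>\<^sub>m 1\<^sub>m d" using card_sig_ker_eq_iff assms by blast
  then show "\<exists>l\<in>K. twisted_prod \<sigma> n d a = l \<cdot>\<^sub>m 1\<^sub>m d" using Norm_in_K by blast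
qed

end

section \<open>Frobenius powers and the concrete extension\<close>

lemma funpow_power: "((\<lambda>x :: 'a::monoid_mult. x ^ m) ^^ i) x = x ^ (m ^ i)"
  by (induction i) (auto simp flip: power_mult simp: mult.commute)

text \<open>Fermat's argument in \<open>K - {0}\<close> makes all of \<open>K\<close> roots of x^q -
  x, which has at most \<open>q\<close> roots.\<close>

lemma power_eq_self_iff_mem_subfield:
  fixes K :: "'a::{field,finite} set"
  assumes K: "is_subfield K" and q: "card K = q"
  shows "x ^ q = x \<longleftrightarrow> x \<in> K"
proof -
  have q1: "q > 1"
  proof -
    have "card {0, 1 :: 'a} \<le> card K"
      using K by (intro card_mono) (auto simp: is_subfield_def)
    then show ?thesis using q by simp
  qed
  have sub: "y ^ q = y" if "y \<in> K" for y
  proof (cases "y = 0")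
    case False
    let ?U = "K - {0}"
    \<comment> \<open>Multiplication by \<open>y\<close> permutes the nonzero elements of
      \<open>K\<close>, so it preserves their product.\<close>
    have "(\<lambda>w. y * w) ` ?U = ?U"
      using False that K by (intro endo_inj_surj) (auto simp: inj_on_def is_subfield_def)
    then have "prod (\<lambda>w. w) ?U = prod (\<lambda>w. y * w) ?U"
      using prod.reindex[of "\<lambda>w. y * w" ?U "\<lambda>w. w"] False by (simp add: inj_on_def)
    also have "\<dots> = y ^ card ?U * prod (\<lambda>w. w) ?U" by (simp add: prod.distrib)
    finally have "y ^ card ?U = 1" by (simp add: prod_zero_iff)
    moreover have "q = Suc (card ?U)"
      using card_Suc_Diff1[of K 0] K q unfolding is_subfield_def by (metis finite)
    ultimately show ?thesis by (metis power_Suc mult.right_neutral)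
  qed (use q1 in simp)
  define p where "p = monom 1 q - monom (1 :: 'a) 1"
  have "coeff p q = 1" using q1 by (simp add: p_def)
  then have "p \<noteq> 0" by auto
  have roots: "{y. poly p y = 0} = {y. y ^ q = y}" by (auto simp: p_def poly_monom)
  have "degree p \<le> q" unfolding p_def using q1
    by (intro degree_diff_le) (auto intro: order.trans[OF degree_monom_le])
  then have "card {y :: 'a. y ^ q = y} \<le> card K"
    using card_poly_roots_bound[OF \<open>p \<noteq> 0\<close>] unfolding roots q by linarith
  moreover have "K \<subseteq> {y. y ^ q = y}" using sub by auto
  ultimately have "K = {y. y ^ q = y}" by (intro card_seteq) auto
  then show ?thesis by blast
qed

theorem theorem7:
  fixes K :: "'a::{field,finite} set" and \<sigma> :: "'a \<Rightarrow> 'a"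
    and q n s d :: nat and a :: "nat \<Rightarrow> 'a"
  assumes "primepow q" and "n \<ge> 1"
    and "card (UNIV :: 'a set) = q ^ n"
    and "is_subfield K" and "card K = q"
    and "gal_generator K \<sigma>"
    and "coprime s n" and "\<And>x. \<sigma> x = x ^ (q ^ s)"
    and "d \<ge> 1" and "a d \<noteq> 0" and "a 0 \<noteq> 0"
  shows "(card {y. poly (proj_poly q s d a) y = 0} = (q ^ d - 1) div (q - 1) \<longleftrightarrow>
            (\<exists>l\<in>K. twisted_prod \<sigma> n d a = l \<cdot>\<^sub>m 1\<^sub>m d)) \<and>
         (card {x. poly (lin_poly q s d a) x = 0} = q ^ d \<longleftrightarrow>
            twisted_prod \<sigma> n d a = 1\<^sub>m d)"
proof -
  have gal: "bij \<sigma>" "\<And>x y. \<sigma> (x + y) = \<sigma> x + \<sigma> y" "\<And>x y. \<sigma> (x * y) = \<sigma> x * \<sigma> y"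
    "\<And>x. x \<in> K \<Longrightarrow> \<sigma> x = x"
    using \<open>gal_generator K \<sigma>\<close> by (auto simp: gal_generator_def gal_def)
  have \<sigma>: "\<sigma> = (\<lambda>x. x ^ (q ^ s))" using assms(8) by auto
  have funpow: "(\<sigma> ^^ i) x = x ^ (q ^ (s * i))" for i x
    by (simp add: \<sigma> funpow_power power_mult)
  have "is_subfield (UNIV :: 'a set)" by (simp add: is_subfield_def)
  then have "x ^ (q ^ n) = x" for x :: 'a
    using power_eq_self_iff_mem_subfield assms(3) by blast
  then have Frob_n: "x ^ (q ^ (n * k)) = x" for x :: 'a and k
    by (induction k) (simp_all add: power_add power_mult)
  have fixed: "\<sigma> x = x \<longleftrightarrow> x \<in> K" for x
  proof
    assume x: "\<sigma> x = x"
    \<comment> \<open>With \<open>u\<close> inverse to \<open>s\<close> modulo \<open>n\<close>,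
      \<open>\<sigma> ^^ u\<close> is the \<open>q\<close>-power map, so fixed points of
      \<open>\<sigma>\<close> satisfy x^q = x.\<close>
    obtain u where u: "[s * u = 1] (mod n)"
      using cong_solve_coprime_nat[OF \<open>coprime s n\<close>] by auto
    have red: "x ^ (q ^ k) = x ^ (q ^ (k mod n))" for k
    proof -
      have "x ^ (q ^ k) = (x ^ (q ^ (n * (k div n)))) ^ (q ^ (k mod n))"
        by (simp flip: power_mult power_add)
      then show ?thesis by (simp add: Frob_n)
    qed
    have "(\<sigma> ^^ u) x = x" using x by (induction u) auto
    then have "x ^ (q ^ (s * u)) = x" by (simp add: funpow)
    then have "x ^ q = x" using red[of "s * u"] red[of 1] u by (simp add: cong_def)
    then show "x \<in> K" using power_eq_self_iff_mem_subfield assms(4,5) by blast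
  qed (rule gal(4))
  interpret finite_cyclic_extension \<sigma> K q n
  proof
    show "(\<sigma> ^^ n) x = x" for x using Frob_n[of x s] by (simp add: funpow mult.commute)
    show "inj \<sigma>" using gal(1) by (rule bij_is_inj)
  qed (rule gal fixed assms)+
  have "poly (proj_poly q s d a) y = proj_eval a d y" for y
    by (simp add: proj_poly_def proj_eval_def sig_pow_def poly_sum poly_monom funpow power_sum)
  \<comment> \<open>The roots of \<open>L\<close> are the kernel at \<open>z = 1\<close>, whose norm
    is 1; hence the identity matrix in the second claim.\<close>
  moreover have "poly (lin_poly q s d a) x = sig_op 1 a d x" for x
    by (simp add: lin_poly_def sig_op_def poly_sum poly_monom twist_funpow_eq funpow)
  moreover have "1 \<cdot>\<^sub>m 1\<^sub>m d = (1\<^sub>m d :: 'a mat)" by (rule eq_matI) auto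
  ultimately show ?thesis
    using card_proj_roots_eq_iff[of a d] twisted_prod_scalar_iff_card_sig_ker[of d a]
      card_sig_ker_eq_iff[of 1 d a] assms(9-11)
    by (simp add: sig_ker_def)
qed

end
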